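(* Let $\alpha,\beta>-1$, let $P^{(\alpha,\beta)}_{n,k}$ be the Laguerre-Jacobi Koornwinder polynomials, and let $\langle f,g\rangle=\int_{\Omega}f(x,y)g(x,y)\,x^{\alpha-\beta}e^{-x}(x-y)^{\beta}\,dx\,dy$ with $\Omega=\{(x,y): -x<y<x,\ x>0\}$. Let $n,m\in\mathbb{N}_0$ and $0\leq j\leq m$. If $k\geq 0$ and $n\geq k+1$, then $$\Big\langle P_{m,j}^{(\alpha,\beta)},\frac{\partial}{\partial\alpha}P_{n,k}^{(\alpha,\beta)}\Big\rangle=\begin{cases}0, & k\neq j,\\ 0, & k=j,\ m\geq n,\\ G_{n,k,m}^{(\alpha,\beta)}, & n>m\geq k=j,\end{cases}$$ and if $n=k\geq 0$, then $\Big\langle P_{m,j}^{(\alpha,\beta)},\frac{\partial}{\partial\alpha}P_{n,n}^{(\alpha,\beta)}\Big\rangle=0$, where $$G_{n,k,m}^{(\alpha,\beta)}=\frac{1}{n-m}\,s_{m,k}^{(\alpha,\beta)},\qquad s_{n,k}^{(\alpha,\beta)}=\frac{2^{\beta+1}\,\Gamma(\alpha+n+k+2)}{(n-k)!\,(\beta+2k+1)}.$$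
   Context: The classical Jacobi polynomials are $P_{n}^{(a,b)}(x)=\frac{(-1)^{n}}{2^{n}n!}(1-x)^{-a}(1+x)^{-b}\frac{d^{n}}{dx^{n}}\{(1-x)^{n+a}(1+x)^{n+b}\}$ and the generalized Laguerre polynomials are $L_{n}^{(a)}(x)=\frac{x^{-a}e^{x}}{n!}\frac{d^{n}}{dx^{n}}\{e^{-x}x^{n+a}\}$. For $\alpha,\beta>-1$ and integers $0\le k\le n$, the Laguerre-Jacobi Koornwinder polynomials are $$P^{(\alpha,\beta)}_{n,k}(x,y)=L^{(\alpha+2k+1)}_{n-k}(x)\,x^{k}\,P^{(\beta,0)}_{k}\!\left(\frac{y}{x}\right),$$ where $P_k^{(\beta,0)}$ is a one-variable Jacobi polynomial. The derivative $\partial/\partial\alpha$ is taken with $\beta,x,y$ fixed (and the weight is not differentiated). *)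

theory Defs
  imports "HOL-Analysis.Analysis"
begin

text \<open>
  The Jacobi and Laguerre polynomials are given by their Rodrigues formulas with real powers,
  so \<open>jacobi n a b x\<close> is meaningful for \<open>-1 < x < 1\<close> and \<open>laguerre n a x\<close> for \<open>x > 0\<close>.
  Below they are only evaluated there: \<open>(x, y) \<in> lj_domain\<close> gives \<open>x > 0\<close> and \<open>-1 < y / x < 1\<close>.
\<close>

definition jacobi :: "nat \<Rightarrow> real \<Rightarrow> real \<Rightarrow> real \<Rightarrow> real" where
  "jacobi n a b x =
     (-1) ^ n / (2 ^ n * fact n) * (1 - x) powr (- a) * (1 + x) powr (- b) *
     (deriv ^^ n) (\<lambda>t. (1 - t) powr (real n + a) * (1 + t) powr (real n + b)) x"

definition laguerre :: "nat \<Rightarrow> real \<Rightarrow> real \<Rightarrow> real" where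
  "laguerre n a x =
     x powr (- a) * exp x / fact n * (deriv ^^ n) (\<lambda>t. exp (- t) * t powr (real n + a)) x"

text \<open>The index condition is \<open>k \<le> n\<close>; otherwise \<open>n - k\<close> is truncated.\<close>

definition lj_koornwinder :: "real \<Rightarrow> real \<Rightarrow> nat \<Rightarrow> nat \<Rightarrow> real \<Rightarrow> real \<Rightarrow> real" where
  "lj_koornwinder \<alpha> \<beta> n k x y =
     laguerre (n - k) (\<alpha> + 2 * real k + 1) x * x ^ k * jacobi k \<beta> 0 (y / x)"

definition lj_koornwinder_dalpha :: "real \<Rightarrow> real \<Rightarrow> nat \<Rightarrow> nat \<Rightarrow> real \<Rightarrow> real \<Rightarrow> real" where
  "lj_koornwinder_dalpha \<alpha> \<beta> n k x y = deriv (\<lambda>a. lj_koornwinder a \<beta> n k x y) \<alpha>"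

definition lj_domain :: "(real \<times> real) set" where
  "lj_domain = {(x, y). - x < y \<and> y < x \<and> x > 0}"

definition lj_weight :: "real \<Rightarrow> real \<Rightarrow> real \<Rightarrow> real \<Rightarrow> real" where
  "lj_weight \<alpha> \<beta> x y = x powr (\<alpha> - \<beta>) * exp (- x) * (x - y) powr \<beta>"

definition lj_inner ::
  "real \<Rightarrow> real \<Rightarrow> (real \<Rightarrow> real \<Rightarrow> real) \<Rightarrow> (real \<Rightarrow> real \<Rightarrow> real) \<Rightarrow> real" where
  "lj_inner \<alpha> \<beta> f g =
     set_lebesgue_integral lborel lj_domain (\<lambda>(x, y). f x y * g x y * lj_weight \<alpha> \<beta> x y)"

definition lj_s :: "real \<Rightarrow> real \<Rightarrow> nat \<Rightarrow> nat \<Rightarrow> real" where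
  "lj_s \<alpha> \<beta> n k =
     2 powr (\<beta> + 1) * Gamma (\<alpha> + real n + real k + 2) / (fact (n - k) * (\<beta> + 2 * real k + 1))"

definition lj_G :: "real \<Rightarrow> real \<Rightarrow> nat \<Rightarrow> nat \<Rightarrow> nat \<Rightarrow> real" where
  "lj_G \<alpha> \<beta> n k m = 1 / (real n - real m) * lj_s \<alpha> \<beta> m k"

end

theory Submission imports Defs
begin

text \<open>
  A Koornwinder polynomial on the wedge is a product of a Laguerre polynomial in \<open>x\<close>, a power of
  \<open>x\<close>, and a Jacobi polynomial in \<open>y / x\<close>. Only the Laguerre factor depends on \<open>\<alpha>\<close>, and its
  parameter derivative expands in Laguerre polynomials of the same parameter and lower degree:
  \<open>\<partial>/\<partial>a L_N(a) = (\<Sum>i<N. L_i(a) / (N - i))\<close> (\<open>has_real_derivative_lag_poly\<close>). This follows by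
  differentiating the addition formula \<open>lag_poly_add\<close> in \<open>h\<close> at \<open>0\<close>.

  In the coordinates \<open>x\<close> and \<open>v = (1 + y / x) / 2\<close> the inner product becomes a product of a Laguerre
  integral over \<open>x > 0\<close> and a Jacobi integral over \<open>0 < v < 1\<close> (\<open>lj_domain_integral\<close>). Jacobi
  orthogonality makes it vanish unless \<open>j = k\<close>. If \<open>j = k\<close>, Laguerre orthogonality selects from the
  expansion the single term of degree \<open>i = m - k\<close>, which is present exactly when \<open>m < n\<close> and carries
  the coefficient \<open>1 / (n - m)\<close>. The squared norms of the two factors, times the
  constant \<open>2 powr (\<beta> + 1)\<close> of the substitution, then give \<open>lj_s\<close>.

  Both orthogonality relations (\<open>laguerre_orthogonality\<close>, \<open>jacobi_orthogonality\<close>) are obtained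
  algebraically. Integrating the explicit polynomials term by term against a power of degree \<open>r\<close>
  gives Gamma and Beta values whose sum is the \<open>n\<close>-th finite difference of a Pochhammer
  polynomial of degree \<open>r\<close> (\<open>finite_difference_pochhammer\<close>). It is zero for \<open>r < n\<close>, and the case
  \<open>r = n\<close> yields the norms.
\<close>

section \<open>Explicit polynomials from the Rodrigues formulas\<close>

text \<open>
  Leibniz' rule. Stating it for two towers \<open>F\<close>, \<open>G\<close> of prescribed derivatives leaves only the
  derivatives of the two factors to be computed when a Rodrigues formula is expanded.
\<close>
lemma iterated_deriv_mult:
  fixes F G :: "nat \<Rightarrow> real \<Rightarrow> real"
  assumes "open S"
    and F: "\<And>i t. t \<in> S \<Longrightarrow> (F i has_real_derivative F (Suc i) t) (at t)"
    and G: "\<And>i t. t \<in> S \<Longrightarrow> (G i has_real_derivative G (Suc i) t) (at t)"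
    and "x \<in> S"
  shows "(deriv ^^ n) (\<lambda>t. F 0 t * G 0 t) x =
           (\<Sum>i\<le>n. real (n choose i) * F i x * G (n - i) x)"
  using \<open>x \<in> S\<close>
proof (induction n arbitrary: x)
  case (Suc n)
  let ?D = "\<lambda>t. \<Sum>i\<le>n. real (n choose i) * F i t * G (n - i) t"
  have "(?D has_real_derivative
          (\<Sum>i\<le>n. real (n choose i) * (F (Suc i) x * G (n - i) x + F i x * G (Suc (n - i)) x))) (at x)"
    by (auto intro!: derivative_eq_intros F G Suc.prems simp: algebra_simps)
  moreover have "eventually (\<lambda>t. (deriv ^^ n) (\<lambda>t. F 0 t * G 0 t) t = ?D t) (nhds x)"
    using Suc.IH eventually_nhds_in_open[OF \<open>open S\<close> Suc.prems] by (auto elim: eventually_mono)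
  ultimately have "(deriv ^^ Suc n) (\<lambda>t. F 0 t * G 0 t) x =
      (\<Sum>i\<le>n. real (n choose i) * (F (Suc i) x * G (n - i) x + F i x * G (Suc (n - i)) x))"
    using deriv_cong_ev[of "(deriv ^^ n) (\<lambda>t. F 0 t * G 0 t)" ?D x x] by (simp add: DERIV_imp_deriv)
  also have "\<dots> = (\<Sum>i\<le>n. real (n choose i) * F (Suc i) x * G (n - i) x) +
                  (\<Sum>i\<le>n. real (n choose i) * F i x * G (Suc n - i) x)"
    by (simp add: sum.distrib algebra_simps Suc_diff_le)
  also have "(\<Sum>i\<le>n. real (n choose i) * F i x * G (Suc n - i) x) =
             (\<Sum>i\<le>Suc n. real (n choose i) * F i x * G (Suc n - i) x)"
    by simp
  also have "\<dots> = F 0 x * G (Suc n) x + (\<Sum>i\<le>n. real (n choose Suc i) * F (Suc i) x * G (n - i) x)"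
    by (subst sum.atMost_Suc_shift) simp
  also have "(\<Sum>i\<le>n. real (n choose i) * F (Suc i) x * G (n - i) x) + \<dots> =
             (\<Sum>i\<le>Suc n. real (Suc n choose i) * F i x * G (Suc n - i) x)"
    unfolding sum.atMost_Suc_shift[of "\<lambda>i. real (Suc n choose i) * F i x * G (Suc n - i) x"]
    by (simp add: sum.distrib algebra_simps)
  finally show ?case .
qed simp

text \<open>
  One step of the derivative tower of a real power: the falling factorial
  \<open>c (c - 1) \<dots> (c - i + 1)\<close> is written as \<open>i!\<close> times a generalised binomial coefficient.
\<close>
lemma has_real_derivative_powr_gbinomial:
  fixes c t :: real
  assumes "t > 0"
  shows "((\<lambda>t. fact i * (c gchoose i) * t powr (c - real i)) has_real_derivative
           fact (Suc i) * (c gchoose Suc i) * t powr (c - real (Suc i))) (at t)"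
proof -
  have "(c gchoose i) * (c - real i) = real (Suc i) * (c gchoose Suc i)"
    using gbinomial_mult_1'[of c i] by (simp add: algebra_simps)
  then have eq: "fact i * (c gchoose i) * (c - real i) = fact (Suc i) * (c gchoose Suc i)"
    by (simp add: algebra_simps)
  have "((\<lambda>t. fact i * (c gchoose i) * t powr (c - real i)) has_real_derivative
          fact i * (c gchoose i) * ((c - real i) * t powr (c - real i - 1))) (at t)"
    using assms by (auto intro!: derivative_eq_intros)
  also have "fact i * (c gchoose i) * ((c - real i) * t powr (c - real i - 1)) =
      fact (Suc i) * (c gchoose Suc i) * t powr (c - real (Suc i))"
    unfolding eq[symmetric] by (simp add: algebra_simps)
  finally show ?thesis .
qed

text \<open>
  The Laguerre polynomial with the binomial coefficient \<open>(n + a) gchoose (n - i)\<close> written as a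
  Pochhammer quotient: this form combines with values of the Gamma function in the moments and
  with the Vandermonde identity in the dependence on \<open>a\<close>.
\<close>
definition lag_poly :: "nat \<Rightarrow> real \<Rightarrow> real poly" where
  "lag_poly n a = (\<Sum>i\<le>n. monom ((-1) ^ i / fact i * (pochhammer (a + real i + 1) (n - i) / fact (n - i))) i)"

lemma poly_lag_poly:
  "poly (lag_poly n a) x =
     (\<Sum>i\<le>n. (-1) ^ i / fact i * (pochhammer (a + real i + 1) (n - i) / fact (n - i)) * x ^ i)"
  by (simp add: lag_poly_def poly_sum poly_monom)

lemma degree_lag_poly: "degree (lag_poly n a) \<le> n"
  unfolding lag_poly_def by (intro degree_sum_le) (auto intro: order.trans[OF degree_monom_le])

lemma coeff_lag_poly:
  "coeff (lag_poly n a) i =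
     (if i \<le> n then (-1) ^ i / fact i * (pochhammer (a + real i + 1) (n - i) / fact (n - i)) else 0)"
  by (simp add: lag_poly_def coeff_sum)

lemma laguerre_eq_poly:
  assumes "x > 0"
  shows "laguerre n a x = poly (lag_poly n a) x"
proof -
  define F where "F i t = (-1) ^ i * exp (- t)" for i and t :: real
  define G where "G i t = fact i * ((real n + a) gchoose i) * t powr (real n + a - real i)" for i t
  have F: "(F i has_real_derivative F (Suc i) t) (at t)" for i t
    unfolding F_def by (auto intro!: derivative_eq_intros)
  have G: "(G i has_real_derivative G (Suc i) t) (at t)" if "t \<in> {0<..}" for i t
    unfolding G_def using that by (intro has_real_derivative_powr_gbinomial) simp
  have "(deriv ^^ n) (\<lambda>t. exp (- t) * t powr (real n + a)) x = (deriv ^^ n) (\<lambda>t. F 0 t * G 0 t) x"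
    by (simp add: F_def G_def)
  also have "\<dots> = (\<Sum>i\<le>n. real (n choose i) * F i x * G (n - i) x)"
    using assms by (intro iterated_deriv_mult[where S = "{0<..}"] F G) auto
  finally have "laguerre n a x =
      (\<Sum>i\<le>n. x powr (- a) * exp x / fact n * (real (n choose i) * F i x * G (n - i) x))"
    by (simp add: laguerre_def sum_distrib_left)
  also have "\<dots> = poly (lag_poly n a) x"
    unfolding poly_lag_poly
  proof (rule sum.cong)
    fix i assume "i \<in> {..n}"
    then have i: "i \<le> n" by simp
    have g: "(real n + a) gchoose (n - i) = pochhammer (a + real i + 1) (n - i) / fact (n - i)"
      using i by (simp add: gbinomial_pochhammer' of_nat_diff algebra_simps)
    have p: "x powr (real n + a - real (n - i)) = x powr a * x ^ i"
      using i assms by (simp add: of_nat_diff powr_add flip: powr_realpow)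
    have b: "real (n choose i) * fact (n - i) / fact n = 1 / fact i"
      using i by (simp add: binomial_fact)
    have "x powr (- a) * exp x / fact n * (real (n choose i) * F i x * G (n - i) x) =
        (real (n choose i) * fact (n - i) / fact n) * (-1) ^ i * (x powr (- a) * x powr a) * (exp x * exp (- x)) *
          ((real n + a) gchoose (n - i)) * x ^ i"
      unfolding F_def G_def p by simp
    also have "\<dots> = (-1) ^ i / fact i * (pochhammer (a + real i + 1) (n - i) / fact (n - i)) * x ^ i"
      unfolding b g using assms by (simp add: powr_minus exp_minus)
    finally show "x powr (- a) * exp x / fact n * (real (n choose i) * F i x * G (n - i) x) = \<dots>" .
  qed simp
  finally show ?thesis .
qed

text \<open>
  The Jacobi polynomial in the variable \<open>v = (1 + t) / 2\<close>, which turns the interval from \<open>-1\<close> to \<open>1\<close>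
  into the unit interval of the Beta integral.
\<close>
definition jac_poly :: "nat \<Rightarrow> real \<Rightarrow> real \<Rightarrow> real poly" where
  "jac_poly n a b = (\<Sum>i\<le>n. smult (((real n + a) gchoose i) * ((real n + b) gchoose (n - i)))
                                  ([:-1, 1:] ^ (n - i) * [:0, 1:] ^ i))"

lemma poly_jac_poly:
  "poly (jac_poly n a b) v =
     (\<Sum>i\<le>n. ((real n + a) gchoose i) * ((real n + b) gchoose (n - i)) * ((v - 1) ^ (n - i) * v ^ i))"
  by (simp add: jac_poly_def poly_sum poly_power)

lemma degree_jac_poly: "degree (jac_poly n a b) \<le> n"
  unfolding jac_poly_def
proof (intro degree_sum_le)
  fix i assume "i \<in> {..n}"
  have "degree ([:-1, 1:] ^ (n - i) * [:0, 1:] ^ i :: real poly) \<le> (n - i) + i"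
    by (intro order.trans[OF degree_mult_le] add_mono order.trans[OF degree_power_le]) auto
  with \<open>i \<in> {..n}\<close> show "degree (smult (((real n + a) gchoose i) * ((real n + b) gchoose (n - i)))
                                  ([:-1, 1:] ^ (n - i) * [:0, 1:] ^ i)) \<le> n"
    by (intro order.trans[OF degree_smult_le]) simp
qed simp

text \<open>
  Each summand of \<open>jac_poly\<close> is monic of degree \<open>n\<close> up to its scalar, so the leading coefficient
  is the sum of these scalars, a Vandermonde convolution.
\<close>
lemma coeff_jac_poly: "coeff (jac_poly n a b) n = (2 * real n + a + b) gchoose n"
proof -
  have "coeff ([:-1, 1:] ^ (n - i) * [:0, 1:] ^ i :: real poly) n = 1" if "i \<le> n" for i
  proof -
    have "degree ([:-1, 1:] ^ (n - i) * [:0, 1:] ^ i :: real poly) = n"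
      using that by (simp add: degree_mult_eq degree_power_eq)
    moreover have "lead_coeff ([:-1, 1:] ^ (n - i) * [:0, 1:] ^ i :: real poly) = 1"
      by (simp add: lead_coeff_mult lead_coeff_power)
    ultimately show ?thesis by simp
  qed
  then have "coeff (jac_poly n a b) n =
      (\<Sum>i\<le>n. ((real n + a) gchoose i) * ((real n + b) gchoose (n - i)))"
    by (simp add: jac_poly_def coeff_sum)
  also have "\<dots> = (2 * real n + a + b) gchoose n"
    using gbinomial_Vandermonde[of "real n + a" "real n + b" n] by (simp add: atMost_atLeast0 algebra_simps)
  finally show ?thesis .
qed

lemma jacobi_eq_poly:
  assumes "-1 < t" "t < 1"
  shows "jacobi n a b t = poly (jac_poly n a b) ((1 + t) / 2)"
proof -
  define F where "F i t = (-1) ^ i * (fact i * ((real n + a) gchoose i) * (1 - t) powr (real n + a - real i))" for i t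
  define G where "G i t = fact i * ((real n + b) gchoose i) * (1 + t) powr (real n + b - real i)" for i t
  have F: "(F i has_real_derivative F (Suc i) t) (at t)" if "t \<in> {-1<..<1}" for i t
  proof -
    have "((\<lambda>t. fact i * ((real n + a) gchoose i) * (1 - t) powr (real n + a - real i)) has_real_derivative
        (fact (Suc i) * ((real n + a) gchoose Suc i) * (1 - t) powr (real n + a - real (Suc i))) * (- 1)) (at t)"
      using that
      by (intro DERIV_chain2[OF has_real_derivative_powr_gbinomial]) (auto intro!: derivative_eq_intros)
    from DERIV_cmult[OF this, of "(-1) ^ i"] show ?thesis
      unfolding F_def by (simp add: mult_ac)
  qed
  have G: "(G i has_real_derivative G (Suc i) t) (at t)" if "t \<in> {-1<..<1}" for i t
  proof -
    have "((\<lambda>t. fact i * ((real n + b) gchoose i) * (1 + t) powr (real n + b - real i)) has_real_derivative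
        (fact (Suc i) * ((real n + b) gchoose Suc i) * (1 + t) powr (real n + b - real (Suc i))) * 1) (at t)"
      using that
      by (intro DERIV_chain2[OF has_real_derivative_powr_gbinomial]) (auto intro!: derivative_eq_intros)
    then show ?thesis unfolding G_def by simp
  qed
  have "(deriv ^^ n) (\<lambda>t. (1 - t) powr (real n + a) * (1 + t) powr (real n + b)) t =
        (deriv ^^ n) (\<lambda>t. F 0 t * G 0 t) t"
    by (simp add: F_def G_def)
  also have "\<dots> = (\<Sum>i\<le>n. real (n choose i) * F i t * G (n - i) t)"
    using assms by (intro iterated_deriv_mult[where S = "{-1<..<1}"] F G) auto
  finally have "jacobi n a b t =
      (\<Sum>i\<le>n. (-1) ^ n / (2 ^ n * fact n) * (1 - t) powr (- a) * (1 + t) powr (- b) *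
        (real (n choose i) * F i t * G (n - i) t))"
    by (simp add: jacobi_def sum_distrib_left)
  also have "\<dots> = poly (jac_poly n a b) ((1 + t) / 2)"
    unfolding poly_jac_poly
  proof (rule sum.cong)
    fix i assume "i \<in> {..n}"
    then have i: "i \<le> n" by simp
    have e: "real n + a - real i = a + real (n - i)"
      using i by (simp add: of_nat_diff)
    have p: "(1 - t) powr (real n + a - real i) = (1 - t) powr a * (1 - t) ^ (n - i)"
      using assms by (simp only: e powr_add) (simp add: powr_realpow)
    have q: "(1 + t) powr (real n + b - real (n - i)) = (1 + t) powr b * (1 + t) ^ i"
      using i assms by (simp add: of_nat_diff powr_add flip: powr_realpow)
    have c: "real (n choose i) * fact i * fact (n - i) / fact n = 1"
      using i by (simp add: binomial_fact)
    have n: "n = (n - i) + i" using i by simp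
    have s: "(-1) ^ n * (-1) ^ i * (1 - t) ^ (n - i) * (1 + t) ^ i / 2 ^ n =
        (((1 + t) / 2) - 1) ^ (n - i) * ((1 + t) / 2) ^ i"
    proof -
      have "((1 + t) / 2) - 1 = (-1) * (1 - t) / 2" by (simp add: field_simps)
      then have r: "(((1 + t) / 2) - 1) ^ (n - i) * ((1 + t) / 2) ^ i =
          (-1) ^ (n - i) * (1 - t) ^ (n - i) * (1 + t) ^ i / 2 ^ n"
        using power_add[of "2::real" "n - i" i] i
        by (simp only: power_mult_distrib power_divide) simp
      have "(-1::real) ^ n * (-1) ^ i = (-1) ^ (n - i)"
        using i by (simp add: minus_one_power_iff)
      then show ?thesis unfolding r by simp
    qed
    have "(-1) ^ n / (2 ^ n * fact n) * (1 - t) powr (- a) * (1 + t) powr (- b) *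
        (real (n choose i) * F i t * G (n - i) t) =
        (real (n choose i) * fact i * fact (n - i) / fact n) *
        (((1 - t) powr (- a) * (1 - t) powr a) * ((1 + t) powr (- b) * (1 + t) powr b)) *
        (((real n + a) gchoose i) * ((real n + b) gchoose (n - i)) *
         ((-1) ^ n * (-1) ^ i * (1 - t) ^ (n - i) * (1 + t) ^ i / 2 ^ n))"
      unfolding F_def G_def p q by (simp add: mult_ac)
    also have "\<dots> = ((real n + a) gchoose i) * ((real n + b) gchoose (n - i)) *
         ((((1 + t) / 2) - 1) ^ (n - i) * ((1 + t) / 2) ^ i)"
      unfolding c s using assms by (simp add: powr_minus)
    finally show "(-1) ^ n / (2 ^ n * fact n) * (1 - t) powr (- a) * (1 + t) powr (- b) *
        (real (n choose i) * F i t * G (n - i) t) = \<dots>" .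
  qed simp
  finally show ?thesis .
qed

section \<open>Moments and orthogonality\<close>

lemma gbinomial_times_Gamma:
  assumes "c - real r > -1"
  shows "(c gchoose r) * Gamma (c - real r + 1) = Gamma (c + 1) / fact r"
proof -
  have "Gamma (c - real r + 1) \<noteq> 0" "c - real r + 1 \<notin> \<int>\<^sub>\<le>\<^sub>0"
    using assms Gamma_real_pos[of "c - real r + 1"] by (force elim!: nonpos_Ints_cases)+
  then show ?thesis
    using pochhammer_Gamma[of "c - real r + 1" r] by (simp add: gbinomial_pochhammer')
qed

lemma pochhammer_times_Gamma:
  fixes x :: real
  assumes "x > 0"
  shows "pochhammer x r * Gamma x = Gamma (x + real r)"
proof -
  have "Gamma x \<noteq> 0" "x \<notin> \<int>\<^sub>\<le>\<^sub>0"
    using assms Gamma_real_pos[of x] by (force elim!: nonpos_Ints_cases)+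
  then show ?thesis
    using pochhammer_Gamma[of x r] by simp
qed

lemma pochhammer_diff_shift:
  fixes x :: "'a :: comm_ring_1"
  shows "pochhammer x (Suc s) - pochhammer (x + 1) (Suc s) = - of_nat (Suc s) * pochhammer (x + 1) s"
  by (subst pochhammer_rec) (simp add: pochhammer_Suc algebra_simps)

text \<open>
  The left-hand side is, up to sign, the \<open>n\<close>-th finite difference of the polynomial
  \<open>pochhammer x r\<close> of degree \<open>r\<close>. It vanishes for \<open>r < n\<close>, where the factor \<open>r choose n\<close> is zero, and
  each difference lowers the degree by one. The moments of both polynomial families
  reduce to this sum.
\<close>
lemma finite_difference_pochhammer:
  fixes x :: real
  shows "(\<Sum>i\<le>n. (-1) ^ i * real (n choose i) * pochhammer (x + real i) r) =
           (-1) ^ n * fact n * real (r choose n) * pochhammer (x + real n) (r - n)"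
proof (induction n arbitrary: x)
  case (Suc n)
  let ?S = "\<lambda>n x. \<Sum>i\<le>n. (-1) ^ i * real (n choose i) * pochhammer (x + real i) r"
  have "?S (Suc n) x = pochhammer x r +
      (\<Sum>i\<le>n. (-1) ^ Suc i * real (n choose Suc i) * pochhammer (x + real (Suc i)) r) - ?S n (x + 1)"
    by (subst sum.atMost_Suc_shift) (simp add: sum.distrib sum_negf sum_subtractf algebra_simps)
  also have "pochhammer x r +
      (\<Sum>i\<le>n. (-1) ^ Suc i * real (n choose Suc i) * pochhammer (x + real (Suc i)) r) =
      (\<Sum>i\<le>Suc n. (-1) ^ i * real (n choose i) * pochhammer (x + real i) r)"
    by (subst sum.atMost_Suc_shift) simp
  also have "\<dots> = ?S n x" by simp
  finally have "?S (Suc n) x = ?S n x - ?S n (x + 1)" .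
  then have *: "?S (Suc n) x = (-1) ^ n * fact n * real (r choose n) *
      (pochhammer (x + real n) (r - n) - pochhammer (x + real n + 1) (r - n))"
    by (simp only: Suc.IH) (simp add: algebra_simps)
  show ?case
  proof (cases "r \<le> n")
    case True
    then show ?thesis unfolding * by simp
  next
    case False
    then obtain s where s: "r - n = Suc s" "r - Suc n = s" "real r = real n + 1 + real s"
      by (metis Suc_diff_Suc not_le add_Suc_right add_diff_inverse_nat of_nat_Suc of_nat_add
          less_imp_le add.assoc add.commute diff_Suc_1 diff_Suc_eq_diff_pred)
    have "Suc n * (r choose Suc n) = (r - n) * (r choose n)"
      by (metis binomial_absorb_comp binomial_absorption mult.commute)
    then have c: "(1 + real n) * real (r choose Suc n) = real (Suc s) * real (r choose n)"
      unfolding s(1) by (metis of_nat_mult of_nat_Suc add.commute)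
    have "?S (Suc n) x = - ((-1) ^ n * fact n * (real (Suc s) * real (r choose n))) * pochhammer (x + real n + 1) s"
      unfolding * s(1) pochhammer_diff_shift by (simp add: algebra_simps)
    also have "\<dots> = (-1) ^ Suc n * fact (Suc n) * real (r choose Suc n) * pochhammer (x + real (Suc n)) (r - Suc n)"
      unfolding c[symmetric] s(2) by (simp add: algebra_simps)
    finally show ?thesis .
  qed
qed simp

lemma set_integral_linear_combination:
  fixes f :: "'i \<Rightarrow> 'a \<Rightarrow> real"
  assumes "\<And>i. i \<in> I \<Longrightarrow> set_integrable M S (f i)"
  shows "set_integrable M S (\<lambda>x. \<Sum>i\<in>I. c i * f i x)"
    and "(LINT x:S|M. (\<Sum>i\<in>I. c i * f i x)) = (\<Sum>i\<in>I. c i * (LINT x:S|M. f i x))"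
proof -
  have eq: "(\<lambda>x. indicator S x *\<^sub>R (\<Sum>i\<in>I. c i * f i x)) = (\<lambda>x. \<Sum>i\<in>I. c i * (indicator S x *\<^sub>R f i x))"
    by (simp add: sum_distrib_left mult_ac)
  have int: "integrable M (\<lambda>x. c i * (indicator S x *\<^sub>R f i x))" if "i \<in> I" for i
    using assms[OF that] unfolding set_integrable_def by (rule integrable_mult_right)
  show "set_integrable M S (\<lambda>x. \<Sum>i\<in>I. c i * f i x)"
    unfolding set_integrable_def eq using int by (rule Bochner_Integration.integrable_sum)
  show "(LINT x:S|M. (\<Sum>i\<in>I. c i * f i x)) = (\<Sum>i\<in>I. c i * (LINT x:S|M. f i x))"
    unfolding set_lebesgue_integral_def eq using int by (simp add: Bochner_Integration.integral_sum)
qed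

lemma weighted_poly_integral:
  fixes w :: "real \<Rightarrow> real"
  assumes "\<And>r. set_integrable M S (\<lambda>x. w x * x ^ r)" and "degree p \<le> n"
  shows "set_integrable M S (\<lambda>x. w x * poly p x)"
    and "(LINT x:S|M. w x * poly p x) = (\<Sum>i\<le>n. coeff p i * (LINT x:S|M. w x * x ^ i))"
proof -
  have "poly p x = (\<Sum>i\<le>n. coeff p i * x ^ i)" for x
    unfolding poly_altdef using assms(2)
    by (intro sum.mono_neutral_left) (auto simp: coeff_eq_0)
  then have eq: "w x * poly p x = (\<Sum>i\<le>n. coeff p i * (w x * x ^ i))" for x
    by (simp add: sum_distrib_left mult_ac)
  show "set_integrable M S (\<lambda>x. w x * poly p x)"
    and "(LINT x:S|M. w x * poly p x) = (\<Sum>i\<le>n. coeff p i * (LINT x:S|M. w x * x ^ i))"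
    unfolding eq using assms(1)
    by (intro set_integral_linear_combination; simp)+
qed

text \<open>
  When \<open>p\<close> annihilates all powers below \<open>n\<close>, pairing it with \<open>q\<close> of degree at most \<open>n\<close> only sees
  the coefficient of \<open>q\<close> at \<open>n\<close>. For \<open>degree q < n\<close> this gives orthogonality, and for \<open>q = p\<close> of
  degree \<open>n\<close> it gives the norm.
\<close>
lemma weighted_orthogonality:
  fixes w :: "real \<Rightarrow> real"
  assumes moments: "\<And>r. set_integrable M S (\<lambda>x. w x * x ^ r)"
    and orth: "\<And>r. r < n \<Longrightarrow> (LINT x:S|M. w x * (poly p x * x ^ r)) = 0"
    and "degree q \<le> n"
  shows "(LINT x:S|M. w x * (poly p x * poly q x)) = coeff q n * (LINT x:S|M. w x * (poly p x * x ^ n))"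
proof -
  have "set_integrable M S (\<lambda>x. w x * poly (p * monom 1 r) x)" for r
    by (rule weighted_poly_integral(1)[OF moments order_refl])
  then have "set_integrable M S (\<lambda>x. (w x * poly p x) * x ^ r)" for r
    by (simp add: poly_monom mult_ac)
  from weighted_poly_integral(2)[OF this \<open>degree q \<le> n\<close>] show ?thesis
    by (simp add: mult.assoc orth flip: lessThan_Suc_atMost)
qed

lemma set_integral_eq_nonneg_has_integral:
  fixes f :: "real \<Rightarrow> real"
  assumes "f \<in> borel_measurable borel" "S \<in> sets borel"
    and "(f has_integral I) S" and "\<And>x. x \<in> S \<Longrightarrow> 0 \<le> f x"
  shows "set_integrable lborel S f" and "(LINT x:S|lborel. f x) = I"
proof -
  have "f absolutely_integrable_on S"
    using assms by (intro nonnegative_absolutely_integrable_1) auto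
  then show *: "set_integrable lborel S f"
    using assms(1,2) unfolding set_integrable_def
    by (subst integrable_completion[symmetric]) auto
  show "(LINT x:S|lborel. f x) = I"
    using set_borel_integral_eq_integral(2)[OF *] assms(3) by (simp add: integral_unique)
qed

lemma gamma_weight_integral:
  fixes a :: real
  assumes "a > -1"
  shows "set_integrable lborel {0<..} (\<lambda>x. x powr a * exp (- x))"
    and "(LINT x:{0<..}|lborel. x powr a * exp (- x)) = Gamma (a + 1)"
proof -
  have "((\<lambda>x. x powr a * exp (- x)) has_integral Gamma (a + 1)) {0..}"
    using Gamma_integral_real[of "a + 1"] assms by (simp add: exp_minus divide_inverse)
  moreover have "negligible (({0..} - {0<..}) \<union> ({0<..} - {0..}) :: real set)"
    by (rule negligible_subset[of "{0}"]) auto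
  ultimately have "((\<lambda>x. x powr a * exp (- x)) has_integral Gamma (a + 1)) {0<..}"
    by (subst (asm) has_integral_spike_set_eq[where T = "{0<..}"])
       (auto intro: negligible_subset)
  then show "set_integrable lborel {0<..} (\<lambda>x. x powr a * exp (- x))"
    and "(LINT x:{0<..}|lborel. x powr a * exp (- x)) = Gamma (a + 1)"
    by (auto intro: set_integral_eq_nonneg_has_integral)
qed

lemma beta_weight_integral:
  fixes a b :: real
  assumes "a > -1" "b > -1"
  shows "set_integrable lborel {0<..<1} (\<lambda>v. v powr b * (1 - v) powr a)"
    and "(LINT v:{0<..<1}|lborel. v powr b * (1 - v) powr a) = Beta (b + 1) (a + 1)"
proof -
  have "((\<lambda>v. v powr b * (1 - v) powr a) has_integral Beta (b + 1) (a + 1)) {0<..<1}"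
    using has_integral_Beta_real[of "b + 1" "a + 1"] assms by (simp add: has_integral_Icc_iff_Ioo)
  then show "set_integrable lborel {0<..<1} (\<lambda>v. v powr b * (1 - v) powr a)"
    and "(LINT v:{0<..<1}|lborel. v powr b * (1 - v) powr a) = Beta (b + 1) (a + 1)"
    by (auto intro: set_integral_eq_nonneg_has_integral)
qed

lemma powr_mult_power: "x > 0 \<Longrightarrow> x powr a * x ^ r = x powr (a + real r)" for x :: real
  by (simp add: powr_add powr_realpow)

lemma laguerre_weight_moment:
  fixes a :: real
  assumes "a > -1"
  shows "set_integrable lborel {0<..} (\<lambda>x. x powr a * exp (- x) * x ^ r)"
    and "(LINT x:{0<..}|lborel. x powr a * exp (- x) * x ^ r) = Gamma (a + real r + 1)"
proof -
  have eq: "x powr a * exp (- x) * x ^ r = x powr (a + real r) * exp (- x)" if "x > 0" for x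
    using powr_mult_power[OF that, of a r] by (simp add: mult_ac)
  show "set_integrable lborel {0<..} (\<lambda>x. x powr a * exp (- x) * x ^ r)"
    using gamma_weight_integral(1)[of "a + real r"] assms eq
    by (subst set_integrable_cong[OF refl refl]) auto
  show "(LINT x:{0<..}|lborel. x powr a * exp (- x) * x ^ r) = Gamma (a + real r + 1)"
    using gamma_weight_integral(2)[of "a + real r"] assms eq
    by (subst set_lebesgue_integral_cong[where g = "\<lambda>x. x powr (a + real r) * exp (- x)"]) auto
qed

text \<open>
  Termwise integration gives \<open>Gamma (a + i + r + 1)\<close> for the \<open>i\<close>-th term. Splitting off
  \<open>Gamma (a + i + 1)\<close>, which the coefficient completes to \<open>Gamma (a + n + 1)\<close>, leaves an alternating
  binomial sum of \<open>pochhammer (a + i + 1) r\<close>, that is, a finite difference.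
\<close>
lemma laguerre_moment:
  fixes a :: real
  assumes "a > -1"
  shows "(LINT x:{0<..}|lborel. x powr a * exp (- x) * (poly (lag_poly n a) x * x ^ r)) =
           (-1) ^ n * real (r choose n) * pochhammer (a + real n + 1) (r - n) * Gamma (a + real n + 1)"
proof -
  have "set_integrable lborel {0<..} (\<lambda>x. (x powr a * exp (- x) * x ^ r) * x ^ s)" for s
    using laguerre_weight_moment(1)[OF assms, of "r + s"] by (simp add: power_add mult.assoc)
  from weighted_poly_integral(2)[OF this degree_lag_poly]
  have "(LINT x:{0<..}|lborel. x powr a * exp (- x) * (poly (lag_poly n a) x * x ^ r)) =
      (\<Sum>i\<le>n. coeff (lag_poly n a) i * (LINT x:{0<..}|lborel. x powr a * exp (- x) * x ^ (r + i)))"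
    by (simp add: mult_ac power_add)
  also have "\<dots> = (\<Sum>i\<le>n. Gamma (a + real n + 1) / fact n *
                        ((-1) ^ i * real (n choose i) * pochhammer (a + 1 + real i) r))"
  proof (rule sum.cong)
    fix i assume "i \<in> {..n}"
    then have i: "i \<le> n" by simp
    have pos: "a + real i + 1 > 0" using assms by simp
    have g1: "Gamma (a + real (r + i) + 1) = pochhammer (a + real i + 1) r * Gamma (a + real i + 1)"
      unfolding pochhammer_times_Gamma[OF pos] by (simp add: algebra_simps)
    have g2: "Gamma (a + real n + 1) = pochhammer (a + real i + 1) (n - i) * Gamma (a + real i + 1)"
      unfolding pochhammer_times_Gamma[OF pos] using i by (simp add: algebra_simps of_nat_diff)
    have b: "real (n choose i) / fact n = 1 / (fact i * fact (n - i))"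
      using i by (simp add: binomial_fact)
    have "Gamma (a + real n + 1) / fact n * ((-1) ^ i * real (n choose i) * pochhammer (a + 1 + real i) r) =
        (real (n choose i) / fact n) * Gamma (a + real n + 1) * (-1) ^ i * pochhammer (a + real i + 1) r"
      by (simp add: algebra_simps)
    also have "\<dots> = coeff (lag_poly n a) i * Gamma (a + real (r + i) + 1)"
      unfolding b g1 g2 using i by (simp add: coeff_lag_poly)
    finally show "coeff (lag_poly n a) i * (LINT x:{0<..}|lborel. x powr a * exp (- x) * x ^ (r + i)) =
        Gamma (a + real n + 1) / fact n * ((-1) ^ i * real (n choose i) * pochhammer (a + 1 + real i) r)"
      unfolding laguerre_weight_moment(2)[OF assms] ..
  qed simp
  also have "\<dots> = (-1) ^ n * real (r choose n) * pochhammer (a + real n + 1) (r - n) * Gamma (a + real n + 1)"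
    unfolding sum_distrib_left[symmetric] finite_difference_pochhammer by (simp add: algebra_simps)
  finally show ?thesis .
qed

lemma laguerre_orthogonality:
  fixes a :: real
  assumes "a > -1"
  shows "(LINT x:{0<..}|lborel. x powr a * exp (- x) * (poly (lag_poly n a) x * poly (lag_poly m a) x)) =
           (if n = m then Gamma (a + real n + 1) / fact n else 0)"
proof (induction n m rule: linorder_wlog)
  case (le m n)
  have "(LINT x:{0<..}|lborel. x powr a * exp (- x) * (poly (lag_poly n a) x * poly (lag_poly m a) x)) =
      coeff (lag_poly m a) n * (LINT x:{0<..}|lborel. x powr a * exp (- x) * (poly (lag_poly n a) x * x ^ n))"
    using le degree_lag_poly[of m a]
    by (intro weighted_orthogonality laguerre_weight_moment(1)[OF assms])
       (auto simp: laguerre_moment[OF assms])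
  also have "\<dots> = (if m = n then Gamma (a + real n + 1) / fact n else 0)"
    using le by (auto simp: coeff_lag_poly laguerre_moment[OF assms])
  finally show ?case by (simp add: mult_ac)
next
  case (sym m n)
  then show ?case by (simp add: mult_ac)
qed

text \<open>
  Every term of the sum defining \<open>jac_poly\<close> has total degree \<open>n\<close> in \<open>v\<close> and \<open>1 - v\<close>, so all the
  resulting Beta values share the denominator \<open>Gamma (a + b + n + r + 2)\<close>. The Gamma factors in
  the numerators are absorbed by the binomial coefficients, and again a finite difference of a
  Pochhammer polynomial remains.
\<close>
lemma jacobi_moment:
  fixes a b :: real
  assumes "a > -1" "b > -1"
  shows "(LINT v:{0<..<1}|lborel. v powr b * (1 - v) powr a * (poly (jac_poly n a b) v * v ^ r)) =
           real (r choose n) * pochhammer (b + real n + 1) (r - n) *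
           (Gamma (real n + a + 1) * Gamma (real n + b + 1) / Gamma (a + b + real n + real r + 2))"
proof -
  let ?c = "\<lambda>i. ((real n + a) gchoose i) * ((real n + b) gchoose (n - i)) * (-1) ^ (n - i)"
  let ?f = "\<lambda>i v. v powr (b + real i + real r) * (1 - v) powr (a + real (n - i))"
  have "v powr b * (1 - v) powr a * (poly (jac_poly n a b) v * v ^ r) = (\<Sum>i\<le>n. ?c i * ?f i v)"
    if "v \<in> {0<..<1}" for v
  proof -
    have "?c i * ?f i v = v powr b * (1 - v) powr a *
        (((real n + a) gchoose i) * ((real n + b) gchoose (n - i)) * ((v - 1) ^ (n - i) * v ^ i) * v ^ r)" for i
    proof -
      have "(v - 1) ^ (n - i) = (-1) ^ (n - i) * (1 - v) ^ (n - i)"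
        by (subst power_mult_distrib[symmetric]) simp
      moreover have "v powr (b + real i + real r) = v powr b * v ^ i * v ^ r"
        and "(1 - v) powr (a + real (n - i)) = (1 - v) powr a * (1 - v) ^ (n - i)"
        using that by (auto simp: powr_add powr_realpow)
      ultimately show ?thesis by (simp add: mult_ac)
    qed
    then show ?thesis
      by (simp only: poly_jac_poly sum_distrib_left sum_distrib_right)
  qed
  then have "(LINT v:{0<..<1}|lborel. v powr b * (1 - v) powr a * (poly (jac_poly n a b) v * v ^ r)) =
      (LINT v:{0<..<1}|lborel. (\<Sum>i\<le>n. ?c i * ?f i v))"
    by (intro set_lebesgue_integral_cong) auto
  also have "\<dots> = (\<Sum>i\<le>n. ?c i * (LINT v:{0<..<1}|lborel. ?f i v))"
    using assms by (intro set_integral_linear_combination(2) beta_weight_integral(1)) auto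
  also have "\<dots> = (\<Sum>i\<le>n. Gamma (real n + a + 1) * Gamma (real n + b + 1) /
        (fact n * Gamma (a + b + real n + real r + 2)) * (-1) ^ n *
        ((-1) ^ i * real (n choose i) * pochhammer (b + 1 + real i) r))"
  proof (rule sum.cong)
    fix i assume "i \<in> {..n}"
    then have i: "i \<le> n" by simp
    have ni: "real (n - i) = real n - real i" using i by (simp add: of_nat_diff)
    have i_less: "real i < 1 + (a + real n)" using assms(1) of_nat_mono[OF i, where 'a = real] by linarith
    have g1: "((real n + a) gchoose i) * Gamma (real n + a - real i + 1) = Gamma (real n + a + 1) / fact i"
      using assms(1) of_nat_mono[OF i, where 'a = real] by (intro gbinomial_times_Gamma) linarith
    have g2: "((real n + b) gchoose (n - i)) * Gamma (b + real i + 1) = Gamma (real n + b + 1) / fact (n - i)"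
      using gbinomial_times_Gamma[of "real n + b" "n - i"] assms i by (simp add: ni algebra_simps)
    have g3: "Gamma (b + real i + real r + 1) = pochhammer (b + real i + 1) r * Gamma (b + real i + 1)"
      using pochhammer_times_Gamma[of "b + real i + 1" r] assms by (simp add: algebra_simps)
    have s: "(-1::real) ^ (n - i) = (-1) ^ n * (-1) ^ i"
      using i by (simp add: minus_one_power_iff)
    have bi: "real (n choose i) / fact n = 1 / (fact i * fact (n - i))"
      using i by (simp add: binomial_fact)
    have "?c i * (LINT v:{0<..<1}|lborel. ?f i v) =
        ?c i * (Gamma (b + real i + real r + 1) * Gamma (real n + a - real i + 1) /
          Gamma (a + b + real n + real r + 2))"
      using assms by (subst beta_weight_integral(2)) (simp_all add: Beta_def ni algebra_simps i_less)
    also have "\<dots> = (((real n + a) gchoose i) * Gamma (real n + a - real i + 1)) *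
        (((real n + b) gchoose (n - i)) * Gamma (b + real i + 1)) *
        ((-1) ^ n * (-1) ^ i) * pochhammer (b + real i + 1) r / Gamma (a + b + real n + real r + 2)"
      unfolding g3 s by simp
    also have "\<dots> = Gamma (real n + a + 1) * Gamma (real n + b + 1) * (1 / (fact i * fact (n - i))) *
        ((-1) ^ n * (-1) ^ i) * pochhammer (b + real i + 1) r / Gamma (a + b + real n + real r + 2)"
      unfolding g1 g2 by simp
    also have "\<dots> = Gamma (real n + a + 1) * Gamma (real n + b + 1) /
        (fact n * Gamma (a + b + real n + real r + 2)) * (-1) ^ n *
        ((-1) ^ i * real (n choose i) * pochhammer (b + 1 + real i) r)"
      unfolding bi[symmetric] by (simp add: algebra_simps)
    finally show "?c i * (LINT v:{0<..<1}|lborel. ?f i v) = \<dots>" .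
  qed simp
  also have "\<dots> = ((-1) ^ n * (-1) ^ n) * real (r choose n) * pochhammer (b + real n + 1) (r - n) *
           (Gamma (real n + a + 1) * Gamma (real n + b + 1) / Gamma (a + b + real n + real r + 2))"
    unfolding sum_distrib_left[symmetric] finite_difference_pochhammer by (simp add: algebra_simps)
  finally show ?thesis by simp
qed

lemma jacobi_weight_moment:
  fixes a b :: real
  assumes "a > -1" "b > -1"
  shows "set_integrable lborel {0<..<1} (\<lambda>v. v powr b * (1 - v) powr a * v ^ r)"
proof -
  have "v powr b * (1 - v) powr a * v ^ r = v powr (b + real r) * (1 - v) powr a" if "v > 0" for v
    using powr_mult_power[OF that, of b r] by (simp add: mult_ac)
  then show ?thesis
    using beta_weight_integral(1)[of a "b + real r"] assms
    by (subst set_integrable_cong[OF refl refl]) auto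
qed

text \<open>
  For \<open>b = 0\<close> the squared norm is a rational function of \<open>n\<close> and \<open>a\<close>, because the leading coefficient
  \<open>(2 n + a) gchoose n\<close> turns \<open>Gamma (n + a + 1)\<close> into \<open>Gamma (2 n + a + 1) / n!\<close>, the neighbour of the
  Gamma value in the denominator.
\<close>
lemma jacobi_orthogonality:
  fixes a :: real
  assumes "a > -1"
  shows "(LINT v:{0<..<1}|lborel. v powr 0 * (1 - v) powr a * (poly (jac_poly n a 0) v * poly (jac_poly m a 0) v)) =
           (if n = m then 1 / (2 * real n + a + 1) else 0)"
proof (induction n m rule: linorder_wlog)
  case (le m n)
  have "(LINT v:{0<..<1}|lborel. v powr 0 * (1 - v) powr a * (poly (jac_poly n a 0) v * poly (jac_poly m a 0) v)) =
      coeff (jac_poly m a 0) n *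
        (LINT v:{0<..<1}|lborel. v powr 0 * (1 - v) powr a * (poly (jac_poly n a 0) v * v ^ n))"
    using le degree_jac_poly[of m a 0] assms
    by (intro weighted_orthogonality jacobi_weight_moment) (auto simp: jacobi_moment simp del: powr_zero_eq_one)
  also have "\<dots> = (if m = n then 1 / (2 * real n + a + 1) else 0)"
  proof (cases "m = n")
    case True
    have pos: "2 * real n + a + 1 > 0" using assms by simp
    have "((2 * real n + a) gchoose n) * Gamma (real n + a + 1) = Gamma (2 * real n + a + 1) / fact n"
      using gbinomial_times_Gamma[of "2 * real n + a" n] assms by (simp add: algebra_simps)
    moreover have "Gamma (a + real n + real n + 2) = (2 * real n + a + 1) * Gamma (2 * real n + a + 1)"
      using pochhammer_times_Gamma[OF pos, of 1] by (simp add: algebra_simps)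
    moreover have "Gamma (2 * real n + a + 1) \<noteq> 0"
      using Gamma_real_pos[OF pos] by simp
    moreover have "Gamma (real n + 1) = fact n"
      using Gamma_fact[of n, where 'a = real] by (simp add: add.commute)
    ultimately have "((2 * real n + a) gchoose n) *
        (Gamma (real n + a + 1) * Gamma (real n + 1) / Gamma (a + real n + real n + 2)) = 1 / (2 * real n + a + 1)"
      using pos by (simp add: mult.assoc[symmetric])
    with True assms show ?thesis
      by (simp add: coeff_jac_poly jacobi_moment del: powr_zero_eq_one)
  next
    case False
    then have "coeff (jac_poly m a 0) n = 0"
      using le degree_jac_poly[of m a 0] by (intro coeff_eq_0) simp
    with False show ?thesis by simp
  qed
  finally show ?case by (simp add: mult_ac)
next
  case (sym m n)
  then show ?case by (simp add: mult_ac)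
qed

section \<open>Parameter derivative of the Laguerre polynomials\<close>

text \<open>
  The coefficients of \<open>lag_poly n (a + h)\<close> involve \<open>pochhammer (a + j + 1 + h) (n - j)\<close>, and the
  Vandermonde identity for Pochhammer symbols separates \<open>h\<close> from the rest.
\<close>
lemma lag_poly_add:
  "lag_poly n (a + h) = (\<Sum>i\<le>n. smult (pochhammer h (n - i) / fact (n - i)) (lag_poly i a))"
proof (rule poly_eqI)
  fix j
  show "coeff (lag_poly n (a + h)) j =
      coeff (\<Sum>i\<le>n. smult (pochhammer h (n - i) / fact (n - i)) (lag_poly i a)) j"
  proof (cases "j \<le> n")
    case True
    let ?z = "a + real j + 1"
    have b: "real ((n - j) choose k) / fact (n - j) = 1 / (fact k * fact (n - j - k))" if "k \<le> n - j" for k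
      using that by (simp add: binomial_fact)
    have "pochhammer (?z + h) (n - j) / fact (n - j) =
        (\<Sum>k\<le>n - j. (real ((n - j) choose k) / fact (n - j)) * pochhammer ?z k * pochhammer h (n - j - k))"
      by (simp add: pochhammer_binomial_sum sum_divide_distrib)
    also have "\<dots> = (\<Sum>k\<le>n - j. pochhammer h (n - j - k) / fact (n - j - k) * (pochhammer ?z k / fact k))"
      by (intro sum.cong) (auto simp: b mult_ac)
    also have "\<dots> = (\<Sum>i\<in>{j..n}. pochhammer h (n - i) / fact (n - i) * (pochhammer ?z (i - j) / fact (i - j)))"
      using True by (intro sum.reindex_bij_witness[of _ "\<lambda>i. i - j" "\<lambda>k. k + j"]) (auto simp: add.commute)
    finally have v: "pochhammer (?z + h) (n - j) / fact (n - j) =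
        (\<Sum>i\<in>{j..n}. pochhammer h (n - i) / fact (n - i) * (pochhammer ?z (i - j) / fact (i - j)))" .
    have "coeff (\<Sum>i\<le>n. smult (pochhammer h (n - i) / fact (n - i)) (lag_poly i a)) j =
        (\<Sum>i\<le>n. pochhammer h (n - i) / fact (n - i) * coeff (lag_poly i a) j)"
      by (simp add: coeff_sum)
    also have "\<dots> = (\<Sum>i\<in>{j..n}. pochhammer h (n - i) / fact (n - i) * coeff (lag_poly i a) j)"
      by (intro sum.mono_neutral_right) (auto simp: coeff_lag_poly)
    also have "\<dots> = (\<Sum>i\<in>{j..n}. (-1) ^ j / fact j *
        (pochhammer h (n - i) / fact (n - i) * (pochhammer ?z (i - j) / fact (i - j))))"
      by (intro sum.cong) (auto simp: coeff_lag_poly mult_ac)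
    also have "\<dots> = (-1) ^ j / fact j * (pochhammer (?z + h) (n - j) / fact (n - j))"
      unfolding v sum_distrib_left ..
    also have "\<dots> = coeff (lag_poly n (a + h)) j"
      using True by (simp add: coeff_lag_poly algebra_simps)
    finally show ?thesis ..
  qed (auto simp: coeff_lag_poly coeff_sum)
qed

text \<open>
  Since \<open>pochhammer z (Suc k) = z * pochhammer (z + 1) k\<close>, the derivative at \<open>0\<close> is the value of the
  second factor there, \<open>pochhammer 1 k = k!\<close>.
\<close>
lemma has_real_derivative_pochhammer_0:
  "((\<lambda>z::real. pochhammer z (Suc k)) has_real_derivative fact k) (at 0)"
proof -
  have "isCont (\<lambda>z::real. pochhammer (z + 1) k) 0"
    unfolding pochhammer_prod by (intro continuous_intros)
  then show ?thesis
    unfolding CARAT_DERIV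
    by (intro exI[of _ "\<lambda>z. pochhammer (z + 1) k"]) (auto simp: pochhammer_rec pochhammer_fact)
qed

definition lag_poly_deriv :: "nat \<Rightarrow> real \<Rightarrow> real poly" where
  "lag_poly_deriv n a = (\<Sum>i<n. smult (1 / real (n - i)) (lag_poly i a))"

text \<open>
  In the addition formula \<open>h\<close> occurs only in \<open>pochhammer h (n - i) / (n - i)!\<close>. At \<open>h = 0\<close> this has
  derivative \<open>(n - i - 1)! / (n - i)! = 1 / (n - i)\<close>, and the term with \<open>i = n\<close> is constant.
\<close>
lemma has_real_derivative_lag_poly:
  "((\<lambda>b. poly (lag_poly n b) x) has_real_derivative poly (lag_poly_deriv n a) x) (at a)"
proof -
  have d: "((\<lambda>z::real. pochhammer z m / fact m) has_real_derivative (if m = 0 then 0 else 1 / real m)) (at 0)" for m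
  proof (cases m)
    case (Suc k)
    have "fact k / fact m = 1 / real m" by (simp add: Suc)
    with DERIV_cdivide[OF has_real_derivative_pochhammer_0, of k "fact m"] Suc show ?thesis by simp
  qed simp
  have "((\<lambda>h. poly (lag_poly n (a + h)) x) has_real_derivative
      (\<Sum>i\<le>n. (if n - i = 0 then 0 else 1 / real (n - i)) * poly (lag_poly i a) x)) (at 0)"
    unfolding lag_poly_add poly_sum poly_smult by (intro DERIV_sum DERIV_cmult_right d)
  also have "(\<Sum>i\<le>n. (if n - i = 0 then 0 else 1 / real (n - i)) * poly (lag_poly i a) x) =
      poly (lag_poly_deriv n a) x"
    by (simp add: lag_poly_deriv_def poly_sum flip: lessThan_Suc_atMost)
  finally show ?thesis
    using DERIV_at_within_shift[of "\<lambda>b. poly (lag_poly n b) x" _ a 0 UNIV] by (simp add: DERIV_shift)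
qed

section \<open>Separation of variables on the wedge\<close>

text \<open>
  The substitution \<open>y = - x + 2 x v\<close> maps the slice of the wedge over \<open>x\<close> to the unit interval in
  \<open>v\<close>. It turns \<open>x - y\<close> into \<open>2 x (1 - v)\<close>, so that \<open>x powr (\<alpha> - \<beta>) * (x - y) powr \<beta>\<close> becomes
  \<open>2 powr \<beta> * x powr \<alpha> * (1 - v) powr \<beta>\<close>. The Jacobian \<open>2 x\<close> supplies one more factor \<open>2\<close> and
  raises the power of \<open>x\<close> to \<open>\<alpha> + 1\<close>. The same computation for absolute values gives integrability.
\<close>
lemma lj_domain_integral:
  fixes f g :: "real \<Rightarrow> real"
  assumes [measurable]: "f \<in> borel_measurable borel" "g \<in> borel_measurable borel"
    and f: "set_integrable lborel {0<..} (\<lambda>x. x powr (\<alpha> + 1) * exp (- x) * f x)"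
    and g: "set_integrable lborel {0<..<1} (\<lambda>v. (1 - v) powr \<beta> * g v)"
  shows "set_integrable lborel lj_domain (\<lambda>(x, y). f x * g ((1 + y / x) / 2) * lj_weight \<alpha> \<beta> x y)"
    and "(LINT (x, y):lj_domain|lborel. f x * g ((1 + y / x) / 2) * lj_weight \<alpha> \<beta> x y) =
           2 powr (\<beta> + 1) * (LINT x:{0<..}|lborel. x powr (\<alpha> + 1) * exp (- x) * f x) *
             (LINT v:{0<..<1}|lborel. (1 - v) powr \<beta> * g v)"
proof -
  \<comment> \<open>The integrand extended by zero, spelled out with a conditional so that its measurability is evident.\<close>
  define F where "F = (\<lambda>(x, y). if - x < y \<and> y < x \<and> x > 0
      then f x * g ((1 + y / x) / 2) * (x powr (\<alpha> - \<beta>) * exp (- x) * (x - y) powr \<beta>) else 0)"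
  define H where "H v = indicator {0<..<1} v *\<^sub>R ((1 - v) powr \<beta> * g v)" for v
  define K where "K x = indicator {0<..} x *\<^sub>R (x powr (\<alpha> + 1) * exp (- x) * f x)" for x
  have F_eq: "F = (\<lambda>p. indicator lj_domain p *\<^sub>R (case p of (x, y) \<Rightarrow> f x * g ((1 + y / x) / 2) * lj_weight \<alpha> \<beta> x y))"
    by (auto simp: F_def lj_domain_def lj_weight_def indicator_def fun_eq_iff)
  have intH: "integrable lborel H" and intK: "integrable lborel K"
    using g f unfolding set_integrable_def H_def K_def .
  have [measurable]: "F \<in> borel_measurable (lborel \<Otimes>\<^sub>M lborel)"
    unfolding F_def by measurable

  have slice: "F (x, - x + 2 * x * v) = 2 powr \<beta> * (x powr \<alpha> * exp (- x) * f x) * H v" if "x > 0" for x v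
  proof (cases "0 < v \<and> v < 1")
    case True
    have "x - (- x + 2 * x * v) = 2 * (x * (1 - v))" by (simp add: algebra_simps)
    then have "(x - (- x + 2 * x * v)) powr \<beta> = 2 powr \<beta> * (x powr \<beta> * (1 - v) powr \<beta>)"
      using that True by (simp add: powr_mult)
    moreover have "x powr (\<alpha> - \<beta>) * x powr \<beta> = x powr \<alpha>"
      by (simp flip: powr_add)
    moreover have "(1 + (- x + 2 * x * v) / x) / 2 = v"
      using that by (simp add: field_simps)
    moreover have "- x < - x + 2 * x * v" "- x + 2 * x * v < x"
      using that True mult_strict_left_mono[of v 1 x] by auto
    ultimately show ?thesis
      using that True by (simp add: F_def H_def mult_ac)
  next
    case False
    then have "\<not> (- x < - x + 2 * x * v \<and> - x + 2 * x * v < x)"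
      using that mult_left_mono[of 1 v x] by (auto simp: zero_less_mult_iff not_less)
    with False show ?thesis by (auto simp: F_def H_def)
  qed
  have F_neg: "F (x, y) = 0" if "x \<le> 0" for x y
    using that by (simp add: F_def)

  have int_slice: "integrable lborel (\<lambda>y. F (x, y))" for x
  proof (cases "x > 0")
    case True
    then have "integrable lborel (\<lambda>v. F (x, - x + 2 * x * v))"
      unfolding slice[OF True] using intH by (intro integrable_mult_right)
    with True show ?thesis
      by (subst (asm) lborel_integrable_real_affine_iff) simp_all
  qed (simp add: F_neg)
  have slice_integral: "(\<integral>y. F (x, y) \<partial>lborel) = 2 powr (\<beta> + 1) * (\<integral>v. H v \<partial>lborel) * K x" for x
  proof (cases "x > 0")
    case True
    then have "(\<integral>y. F (x, y) \<partial>lborel) = 2 * x * (\<integral>v. F (x, - x + 2 * x * v) \<partial>lborel)"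
      by (subst lborel_integral_real_affine[of "2 * x" _ "- x"]) simp_all
    with True show ?thesis
      unfolding slice[OF True] by (simp add: K_def powr_add mult_ac)
  qed (simp add: F_neg K_def)
  have slice_norm: "(\<integral>y. norm (F (x, y)) \<partial>lborel) = 2 powr (\<beta> + 1) * (\<integral>v. \<bar>H v\<bar> \<partial>lborel) * \<bar>K x\<bar>" for x
  proof (cases "x > 0")
    case True
    then have "(\<integral>y. norm (F (x, y)) \<partial>lborel) = 2 * x * (\<integral>v. norm (F (x, - x + 2 * x * v)) \<partial>lborel)"
      by (subst lborel_integral_real_affine[of "2 * x" _ "- x"]) simp_all
    with True show ?thesis
      unfolding slice[OF True] by (simp add: K_def powr_add abs_mult mult_ac)
  qed (simp add: F_neg K_def)

  have int: "integrable (lborel \<Otimes>\<^sub>M lborel) F"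
  proof (rule lborel_pair.Fubini_integrable)
    show "integrable lborel (\<lambda>x. \<integral>y. norm (F (x, y)) \<partial>lborel)"
      unfolding slice_norm using intK by (intro integrable_mult_right integrable_abs)
  qed (use int_slice in simp_all)
  then show "set_integrable lborel lj_domain (\<lambda>(x, y). f x * g ((1 + y / x) / 2) * lj_weight \<alpha> \<beta> x y)"
    by (simp add: set_integrable_def lborel_prod F_eq)
  have "(LINT (x, y):lj_domain|lborel. f x * g ((1 + y / x) / 2) * lj_weight \<alpha> \<beta> x y) =
      integral\<^sup>L (lborel \<Otimes>\<^sub>M lborel) F"
    by (simp add: set_lebesgue_integral_def lborel_prod F_eq)
  also have "\<dots> = (\<integral>x. (\<integral>y. F (x, y) \<partial>lborel) \<partial>lborel)"
    using lborel_pair.integral_fst'[OF int] ..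
  also have "\<dots> = 2 powr (\<beta> + 1) * (\<integral>v. H v \<partial>lborel) * (\<integral>x. K x \<partial>lborel)"
    unfolding slice_integral by simp
  finally show "(LINT (x, y):lj_domain|lborel. f x * g ((1 + y / x) / 2) * lj_weight \<alpha> \<beta> x y) =
           2 powr (\<beta> + 1) * (LINT x:{0<..}|lborel. x powr (\<alpha> + 1) * exp (- x) * f x) *
             (LINT v:{0<..<1}|lborel. (1 - v) powr \<beta> * g v)"
    by (simp add: set_lebesgue_integral_def H_def K_def mult_ac)
qed

section \<open>The Koornwinder polynomials\<close>

lemma lj_koornwinder_eq_poly:
  assumes "(x, y) \<in> lj_domain"
  shows "lj_koornwinder a \<beta> n k x y =
           poly (lag_poly (n - k) (a + 2 * real k + 1)) x * x ^ k * poly (jac_poly k \<beta> 0) ((1 + y / x) / 2)"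
proof -
  have "x > 0" "-1 < y / x" "y / x < 1"
    using assms by (auto simp: lj_domain_def field_simps)
  then show ?thesis
    by (simp add: lj_koornwinder_def laguerre_eq_poly jacobi_eq_poly)
qed

lemma has_real_derivative_lj_koornwinder:
  assumes "(x, y) \<in> lj_domain"
  shows "((\<lambda>a. lj_koornwinder a \<beta> n k x y) has_real_derivative
           poly (lag_poly_deriv (n - k) (\<alpha> + 2 * real k + 1)) x * x ^ k *
             poly (jac_poly k \<beta> 0) ((1 + y / x) / 2)) (at \<alpha>)"
proof -
  have "((\<lambda>a. a + (2 * real k + 1)) has_real_derivative 1) (at \<alpha>)"
    by (auto intro!: derivative_eq_intros)
  from DERIV_chain2[OF has_real_derivative_lag_poly this, of "n - k" x]
  have "((\<lambda>a. poly (lag_poly (n - k) (a + 2 * real k + 1)) x) has_real_derivative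
      poly (lag_poly_deriv (n - k) (\<alpha> + 2 * real k + 1)) x) (at \<alpha>)"
    by (simp add: add.assoc)
  then show ?thesis
    unfolding lj_koornwinder_eq_poly[OF assms] by (intro DERIV_cmult_right)
qed

lemma laguerre_deriv_integral:
  fixes a :: real
  assumes "a > -1"
  shows "(LINT x:{0<..}|lborel. x powr a * exp (- x) * (poly (lag_poly m a) x * poly (lag_poly_deriv n a) x)) =
           (if m < n then 1 / real (n - m) * (Gamma (a + real m + 1) / fact m) else 0)"
proof -
  have "x powr a * exp (- x) * (poly (lag_poly m a) x * poly (lag_poly_deriv n a) x) =
      (\<Sum>i<n. 1 / real (n - i) * (x powr a * exp (- x) * (poly (lag_poly m a) x * poly (lag_poly i a) x)))" for x
    by (simp add: lag_poly_deriv_def poly_sum sum_distrib_left mult_ac)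
  moreover have "set_integrable lborel {0<..} (\<lambda>x. x powr a * exp (- x) * (poly (lag_poly m a) x * poly (lag_poly i a) x))" for i
    using weighted_poly_integral(1)[OF laguerre_weight_moment(1)[OF assms] order_refl, of "lag_poly m a * lag_poly i a"]
    by simp
  ultimately have "(LINT x:{0<..}|lborel. x powr a * exp (- x) * (poly (lag_poly m a) x * poly (lag_poly_deriv n a) x)) =
      (\<Sum>i<n. 1 / real (n - i) * (if m = i then Gamma (a + real m + 1) / fact m else 0))"
    by (simp only: set_integral_linear_combination(2) laguerre_orthogonality[OF assms])
  also have "\<dots> = (\<Sum>i<n. if m = i then 1 / real (n - i) * (Gamma (a + real m + 1) / fact m) else 0)"
    by (intro sum.cong) auto
  finally show ?thesis by (simp add: sum.delta)
qed

text \<open>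
  After separation the \<open>v\<close>-integral pairs two Jacobi polynomials with the same parameters and
  forces \<open>j = k\<close>. In that case the powers \<open>x ^ j\<close> and \<open>x ^ k\<close> raise the exponent \<open>\<alpha> + 1\<close> of the
  \<open>x\<close>-weight to \<open>\<alpha> + 2 k + 1\<close>, which is the parameter of both Laguerre factors. Since the two Laguerre
  degrees are \<open>m - k\<close> and \<open>n - k\<close>, the coefficient \<open>1 / ((n - k) - (m - k))\<close> is \<open>1 / (n - m)\<close>.
\<close>
lemma
  assumes "\<alpha> > -1" "\<beta> > -1" "j \<le> m" "k \<le> n"
  shows lj_integrable_dalpha:
      "set_integrable lborel lj_domain
         (\<lambda>(x, y). lj_koornwinder \<alpha> \<beta> m j x y * lj_koornwinder_dalpha \<alpha> \<beta> n k x y * lj_weight \<alpha> \<beta> x y)"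
    and lj_inner_dalpha:
      "lj_inner \<alpha> \<beta> (lj_koornwinder \<alpha> \<beta> m j) (lj_koornwinder_dalpha \<alpha> \<beta> n k) =
         (if j = k \<and> m < n then lj_G \<alpha> \<beta> n k m else 0)"
proof -
  define p where "p = lag_poly (m - j) (\<alpha> + 2 * real j + 1) * lag_poly_deriv (n - k) (\<alpha> + 2 * real k + 1) * monom 1 (j + k)"
  define q where "q = jac_poly j \<beta> 0 * jac_poly k \<beta> 0"
  have eq: "lj_koornwinder \<alpha> \<beta> m j x y * lj_koornwinder_dalpha \<alpha> \<beta> n k x y * lj_weight \<alpha> \<beta> x y =
      poly p x * poly q ((1 + y / x) / 2) * lj_weight \<alpha> \<beta> x y" if "(x, y) \<in> lj_domain" for x y
    unfolding lj_koornwinder_dalpha_def DERIV_imp_deriv[OF has_real_derivative_lj_koornwinder[OF that]]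
    unfolding lj_koornwinder_eq_poly[OF that]
    by (simp add: p_def q_def poly_monom power_add mult_ac)
  have [measurable]: "poly r \<in> borel_measurable borel" for r :: "real poly"
    by (intro borel_measurable_continuous_onI continuous_intros)
  have p: "set_integrable lborel {0<..} (\<lambda>x. x powr (\<alpha> + 1) * exp (- x) * poly p x)"
    using assms by (intro weighted_poly_integral(1)[OF laguerre_weight_moment(1) order_refl]) simp
  have v0: "v powr 0 * (1 - v) powr \<beta> = (1 - v) powr \<beta>" if "v \<in> {0<..<1}" for v :: real
    using that by simp
  have "set_integrable lborel {0<..<1} (\<lambda>v. v powr 0 * (1 - v) powr \<beta> * poly q v)"
    using assms by (intro weighted_poly_integral(1)[OF jacobi_weight_moment order_refl]) simp_all
  then have q: "set_integrable lborel {0<..<1} (\<lambda>v. (1 - v) powr \<beta> * poly q v)"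
    by (subst (asm) set_integrable_cong[OF refl refl, where f' = "\<lambda>v. (1 - v) powr \<beta> * poly q v"]) (simp_all only: v0)
  have "lj_domain = {p \<in> space (lborel \<Otimes>\<^sub>M lborel). - fst p < snd p \<and> snd p < fst p \<and> fst p > 0}"
    by (auto simp: lj_domain_def space_pair_measure)
  also have "\<dots> \<in> sets (lborel \<Otimes>\<^sub>M lborel)"
    by measurable
  finally have lj_meas: "lj_domain \<in> sets lborel"
    by (simp only: lborel_prod)
  show "set_integrable lborel lj_domain
      (\<lambda>(x, y). lj_koornwinder \<alpha> \<beta> m j x y * lj_koornwinder_dalpha \<alpha> \<beta> n k x y * lj_weight \<alpha> \<beta> x y)"
    using lj_domain_integral(1)[OF _ _ p q]
    by (subst set_integrable_cong[OF refl refl, where f' = "\<lambda>(x, y). poly p x * poly q ((1 + y / x) / 2) * lj_weight \<alpha> \<beta> x y"])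
       (auto simp: eq)
  have "lj_inner \<alpha> \<beta> (lj_koornwinder \<alpha> \<beta> m j) (lj_koornwinder_dalpha \<alpha> \<beta> n k) =
      (LINT (x, y):lj_domain|lborel. poly p x * poly q ((1 + y / x) / 2) * lj_weight \<alpha> \<beta> x y)"
    unfolding lj_inner_def using lj_meas by (intro set_lebesgue_integral_cong) (auto simp: eq)
  also have "\<dots> = 2 powr (\<beta> + 1) * (LINT x:{0<..}|lborel. x powr (\<alpha> + 1) * exp (- x) * poly p x) *
      (LINT v:{0<..<1}|lborel. (1 - v) powr \<beta> * poly q v)"
    by (rule lj_domain_integral(2)[OF _ _ p q]) measurable
  also have "(LINT v:{0<..<1}|lborel. (1 - v) powr \<beta> * poly q v) =
      (LINT v:{0<..<1}|lborel. v powr 0 * (1 - v) powr \<beta> * (poly (jac_poly j \<beta> 0) v * poly (jac_poly k \<beta> 0) v))"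
    by (intro set_lebesgue_integral_cong) (auto simp: q_def)
  also have "\<dots> = (if j = k then 1 / (2 * real k + \<beta> + 1) else 0)"
    using assms by (simp add: jacobi_orthogonality del: powr_zero_eq_one)
  finally have *: "lj_inner \<alpha> \<beta> (lj_koornwinder \<alpha> \<beta> m j) (lj_koornwinder_dalpha \<alpha> \<beta> n k) =
      2 powr (\<beta> + 1) * (LINT x:{0<..}|lborel. x powr (\<alpha> + 1) * exp (- x) * poly p x) *
      (if j = k then 1 / (2 * real k + \<beta> + 1) else 0)" .
  show "lj_inner \<alpha> \<beta> (lj_koornwinder \<alpha> \<beta> m j) (lj_koornwinder_dalpha \<alpha> \<beta> n k) =
         (if j = k \<and> m < n then lj_G \<alpha> \<beta> n k m else 0)"
  proof (cases "j = k")
    case True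
    let ?a = "\<alpha> + 2 * real k + 1"
    have "x powr (\<alpha> + 1) * exp (- x) * poly p x =
        x powr ?a * exp (- x) * (poly (lag_poly (m - k) ?a) x * poly (lag_poly_deriv (n - k) ?a) x)" if "x > 0" for x
      using powr_mult_power[OF that, of "\<alpha> + 1" "k + k"] True
      by (simp add: p_def poly_monom algebra_simps)
    then have "(LINT x:{0<..}|lborel. x powr (\<alpha> + 1) * exp (- x) * poly p x) =
        (LINT x:{0<..}|lborel. x powr ?a * exp (- x) * (poly (lag_poly (m - k) ?a) x * poly (lag_poly_deriv (n - k) ?a) x))"
      by (intro set_lebesgue_integral_cong) auto
    also have "\<dots> = (if m - k < n - k then 1 / real ((n - k) - (m - k)) * (Gamma (?a + real (m - k) + 1) / fact (m - k)) else 0)"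
      using assms by (intro laguerre_deriv_integral) simp
    also have "\<dots> = (if m < n then 1 / (real n - real m) * (Gamma (\<alpha> + real m + real k + 2) / fact (m - k)) else 0)"
      using assms True by (auto simp: of_nat_diff algebra_simps)
    finally show ?thesis
      unfolding * using True by (simp add: lj_G_def lj_s_def algebra_simps)
  qed (simp add: *)
qed

theorem theorem7:
  fixes \<alpha> \<beta> :: real and n k m j :: nat
  assumes "\<alpha> > -1" and "\<beta> > -1" and "j \<le> m"
  shows
    "(k \<le> n \<longrightarrow>
        (\<forall>(x, y) \<in> lj_domain. (\<lambda>a. lj_koornwinder a \<beta> n k x y) differentiable (at \<alpha>)) \<and>
        set_integrable lborel lj_domain
          (\<lambda>(x, y). lj_koornwinder \<alpha> \<beta> m j x y * lj_koornwinder_dalpha \<alpha> \<beta> n k x y *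
             lj_weight \<alpha> \<beta> x y)) \<and>
     (n \<ge> k + 1 \<longrightarrow>
        (k \<noteq> j \<longrightarrow>
           lj_inner \<alpha> \<beta> (lj_koornwinder \<alpha> \<beta> m j) (lj_koornwinder_dalpha \<alpha> \<beta> n k) = 0) \<and>
        (k = j \<and> m \<ge> n \<longrightarrow>
           lj_inner \<alpha> \<beta> (lj_koornwinder \<alpha> \<beta> m j) (lj_koornwinder_dalpha \<alpha> \<beta> n k) = 0) \<and>
        (n > m \<and> m \<ge> k \<and> k = j \<longrightarrow>
           lj_inner \<alpha> \<beta> (lj_koornwinder \<alpha> \<beta> m j) (lj_koornwinder_dalpha \<alpha> \<beta> n k)
             = lj_G \<alpha> \<beta> n k m)) \<and>
     (n = k \<longrightarrow>
        lj_inner \<alpha> \<beta> (lj_koornwinder \<alpha> \<beta> m j) (lj_koornwinder_dalpha \<alpha> \<beta> n n) = 0)"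
proof -
  have "(\<lambda>a. lj_koornwinder a \<beta> n k x y) differentiable (at \<alpha>)" if "(x, y) \<in> lj_domain" for x y
    using has_real_derivative_lj_koornwinder[OF that] real_differentiable_def by blast
  then show ?thesis
    using lj_integrable_dalpha[OF assms] lj_inner_dalpha[OF assms] \<open>j \<le> m\<close> by auto
qed

end
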